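(* Let $[a,b]\subset\mathbb{R}$, $\mu$ be Lebesgue measure on $[a,b]$, $\omega$ a modulus of continuity, $Q=\{q_1,\dots,q_n\}$ a set of $n\in\mathbb{N}$ points of $[a,b]$, $e\in\mathbb{R}^n_+$. Let $k:[a,b]^2\to\mathbb{R}$ be a (measurable) kernel with $$\int_a^b\int_a^b|k(t,s)|^2\,d\mu(t)\,d\mu(s)<1,$$ and let $\Gamma$ be its resolvent kernel. Let $A$ be the solution operator $f\mapsto x=Af$ of the Fredholm equation $x(t)=f(t)+\int_a^bk(t,s)x(s)\,d\mu(s)$, i.e. $$(Af)(t)=f(t)+\int_a^b\Gamma(t,s)f(s)\,d\mu(s),\qquad t\in[a,b].$$ Let $Y\subset\mathfrak{M}([a,b],\mu)$ be a normed lattice containing the space $B_\mu([a,b])$ of $\mu$-essentially bounded functions and such that $A(B_\mu([a,b]))\subset Y$. If $k$ is a.e. non-negative on $[a,b]^2$, then the method $\Phi=A\,L_{\omega,Q,e}$ is an optimal method of recovery of the operator $A$ on the class $H^\omega_\mu([a,b])$ based on information $I_Q$ with $U_e$-error, and $$\mathcal{E}(A;H^\omega_\mu([a,b]);I_Q;U_e)=\mathcal{E}(A;H^\omega_\mu([a,b]);I_Q;U_e;\Phi)=\|A\tau_{\omega,Q,e}\|_Y=\left\|\tau_{\omega,Q,e}(\cdot)+\int_a^b\Gamma((\cdot),s)\,\tau_{\omega,Q,e}(s)\,d\mu(s)\right\|_Y.$$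
   Context: Resolvent kernel: $\Gamma(t,s)=\sum_{n=1}^\infty k_n(t,s)$, $k_1=k$, $k_n(t,s)=\int_a^bk_{n-1}(t,u)k(u,s)\,d\mu(u)$ for $n\ge2$ (equalities a.e.). The formula for $Af$ is used for all $f\in B_\mu([a,b])$. $\mathbb{R}_+=[0,\infty)$. A modulus of continuity is a continuous non-decreasing $\omega:\mathbb{R}_+\to\mathbb{R}_+$ with $\omega(0)=0$ and $\omega(t'+t'')\le\omega(t')+\omega(t'')$. $H^\omega_\mu([a,b])=\{x:[a,b]\to\mathbb{R}:|x(t')-x(t'')|\le\omega(|t'-t''|)\ \forall t',t''\}$. $I_Qx=(x(q_1),\dots,x(q_n))$; $U_e=[-e_1,e_1]\times\dots\times[-e_n,e_n]$; $\tau_{\omega,Q,e}(t)=\min_{1\le j\le n}(e_j+\omega(|t-q_j|))$. Put $\Pi'_j=\{t\in[a,b]:\tau_{\omega,Q,e}(t)=e_j+\omega(|t-q_j|)\}$, $\Pi_1=\Pi'_1$, $\Pi_j=\Pi'_j\setminus\bigcup_{s<j}\Pi_s$; $L_{\omega,Q,e}:\mathbb{R}^n\to B_\mu([a,b])$, $L_{\omega,Q,e}z(t)=z_j$ for $t\in\Pi_j$. $\mathfrak{M}([a,b],\mu)$ is the space of measurable a.e. finite functions modulo a.e. equality, ordered by $x'\prec x''$ iff $x'\le x''$ a.e. A normed lattice $Y\subset\mathfrak{M}([a,b],\mu)$ is a normed space which is a vector lattice for the inherited order with $|x|\prec|y|\Rightarrow\|x\|_Y\le\|y\|_Y$. A method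 of recovery is an arbitrary map $\Phi:\mathbb{R}^n\to Y$; $\mathcal{E}(A;W;I_Q;U_e;\Phi)=\sup_{x\in W}\sup_{z\in I_Qx+U_e}\|Ax-\Phi z\|_Y$; $\mathcal{E}(A;W;I_Q;U_e)=\inf_\Phi\mathcal{E}(A;W;I_Q;U_e;\Phi)$; a method is optimal if it attains this infimum. *)

theory Defs
  imports "HOL-Analysis.Analysis" "HOL-Algebra.Lattice"
begin

text \<open>
  The space of measurable, a.e. finite functions modulo a.e. equality is represented by
  real-valued Lebesgue measurable functions compared with \<open>ae_eq\<close>; a linear subspace of it is
  a set of functions closed under \<open>ae_eq\<close>, and a norm on it is a function invariant under
  \<open>ae_eq\<close>.  Values of such functions outside \<open>{a..b}\<close> are irrelevant.
\<close>

definition meas_fun :: "real \<Rightarrow> real \<Rightarrow> (real \<Rightarrow> real) set" where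
  "meas_fun a b = borel_measurable (lebesgue_on {a..b})"

definition ae_eq :: "real \<Rightarrow> real \<Rightarrow> (real \<Rightarrow> real) \<Rightarrow> (real \<Rightarrow> real) \<Rightarrow> bool" where
  "ae_eq a b f g \<longleftrightarrow> (AE t in lebesgue_on {a..b}. f t = g t)"

definition ae_le :: "real \<Rightarrow> real \<Rightarrow> (real \<Rightarrow> real) \<Rightarrow> (real \<Rightarrow> real) \<Rightarrow> bool" where
  "ae_le a b f g \<longleftrightarrow> (AE t in lebesgue_on {a..b}. f t \<le> g t)"

definition ess_bounded :: "real \<Rightarrow> real \<Rightarrow> (real \<Rightarrow> real) set" where
  "ess_bounded a b =
     {f \<in> meas_fun a b. \<exists>c. AE t in lebesgue_on {a..b}. \<bar>f t\<bar> \<le> c}"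

definition ae_order :: "real \<Rightarrow> real \<Rightarrow> (real \<Rightarrow> real) set \<Rightarrow> (real \<Rightarrow> real) gorder" where
  "ae_order a b Y = \<lparr>carrier = Y, eq = ae_eq a b, le = ae_le a b\<rparr>"

text \<open>
  Suprema are those of the ordered set \<open>Y\<close> itself, so the modulus of \<open>f\<close> is the least upper
  bound in \<open>Y\<close> of \<open>f\<close> and \<open>- f\<close>; it is not required by definition to be the pointwise one.
\<close>

definition lattice_abs ::
  "real \<Rightarrow> real \<Rightarrow> (real \<Rightarrow> real) set \<Rightarrow> (real \<Rightarrow> real) \<Rightarrow> (real \<Rightarrow> real)" where
  "lattice_abs a b Y f = join (ae_order a b Y) f (\<lambda>t. - f t)"

definition normed_lattice ::
  "real \<Rightarrow> real \<Rightarrow> (real \<Rightarrow> real) set \<Rightarrow> ((real \<Rightarrow> real) \<Rightarrow> real) \<Rightarrow> bool" where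
  "normed_lattice a b Y N \<longleftrightarrow>
     Y \<subseteq> meas_fun a b
   \<and> (\<forall>f\<in>Y. \<forall>g\<in>meas_fun a b. ae_eq a b f g \<longrightarrow> g \<in> Y \<and> N g = N f)
   \<and> (\<lambda>t. 0) \<in> Y
   \<and> (\<forall>f\<in>Y. \<forall>g\<in>Y. (\<lambda>t. f t + g t) \<in> Y)
   \<and> (\<forall>c. \<forall>f\<in>Y. (\<lambda>t. c * f t) \<in> Y)
   \<and> (\<forall>f\<in>Y. 0 \<le> N f)
   \<and> (\<forall>f\<in>Y. N f = 0 \<longleftrightarrow> ae_eq a b f (\<lambda>t. 0))
   \<and> (\<forall>c. \<forall>f\<in>Y. N (\<lambda>t. c * f t) = \<bar>c\<bar> * N f)
   \<and> (\<forall>f\<in>Y. \<forall>g\<in>Y. N (\<lambda>t. f t + g t) \<le> N f + N g)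
   \<and> weak_lattice (ae_order a b Y)
   \<and> (\<forall>f\<in>Y. \<forall>g\<in>Y.
        ae_le a b (lattice_abs a b Y f) (lattice_abs a b Y g) \<longrightarrow> N f \<le> N g)"

definition modulus_of_continuity :: "(real \<Rightarrow> real) \<Rightarrow> bool" where
  "modulus_of_continuity \<omega> \<longleftrightarrow>
     (\<forall>t\<ge>0. 0 \<le> \<omega> t) \<and> continuous_on {0..} \<omega> \<and> mono_on {0..} \<omega> \<and> \<omega> 0 = 0
   \<and> (\<forall>s\<ge>0. \<forall>t\<ge>0. \<omega> (s + t) \<le> \<omega> s + \<omega> t)"

text \<open>Members are genuine functions on \<open>{a..b}\<close>, not a.e. classes: they are sampled at points.\<close>

definition H_class :: "real \<Rightarrow> real \<Rightarrow> (real \<Rightarrow> real) \<Rightarrow> (real \<Rightarrow> real) set" where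
  "H_class a b \<omega> =
     {x. \<forall>t'\<in>{a..b}. \<forall>t''\<in>{a..b}. \<bar>x t' - x t''\<bar> \<le> \<omega> \<bar>t' - t''\<bar>}"

text \<open>
  Vectors with \<open>n\<close> real coordinates are the extensional functions \<open>{1..n} \<rightarrow>\<^sub>E UNIV\<close>.
\<close>

definition info_op :: "nat \<Rightarrow> (nat \<Rightarrow> real) \<Rightarrow> (real \<Rightarrow> real) \<Rightarrow> (nat \<Rightarrow> real)" where
  "info_op n q x = (\<lambda>j\<in>{1..n}. x (q j))"

definition error_box :: "nat \<Rightarrow> (nat \<Rightarrow> real) \<Rightarrow> (nat \<Rightarrow> real) set" where
  "error_box n e = (\<Pi>\<^sub>E j\<in>{1..n}. {- e j..e j})"

definition noisy_info ::
  "nat \<Rightarrow> ((real \<Rightarrow> real) \<Rightarrow> (nat \<Rightarrow> real)) \<Rightarrow> (nat \<Rightarrow> real) set \<Rightarrow> (real \<Rightarrow> real)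
    \<Rightarrow> (nat \<Rightarrow> real) set" where
  "noisy_info n I U x = {(\<lambda>j\<in>{1..n}. I x j + u j) | u. u \<in> U}"

definition methods :: "nat \<Rightarrow> (real \<Rightarrow> real) set \<Rightarrow> ((nat \<Rightarrow> real) \<Rightarrow> (real \<Rightarrow> real)) set" where
  "methods n Y = ({1..n} \<rightarrow>\<^sub>E UNIV) \<rightarrow> Y"

definition recovery_error ::
  "nat \<Rightarrow> ((real \<Rightarrow> real) \<Rightarrow> real) \<Rightarrow> ((real \<Rightarrow> real) \<Rightarrow> (real \<Rightarrow> real)) \<Rightarrow> (real \<Rightarrow> real) set
    \<Rightarrow> ((real \<Rightarrow> real) \<Rightarrow> (nat \<Rightarrow> real)) \<Rightarrow> (nat \<Rightarrow> real) set
    \<Rightarrow> ((nat \<Rightarrow> real) \<Rightarrow> (real \<Rightarrow> real)) \<Rightarrow> ereal" where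
  "recovery_error n N A W I U \<Phi> =
     (SUP x\<in>W. SUP z\<in>noisy_info n I U x. ereal (N (\<lambda>t. A x t - \<Phi> z t)))"

definition optimal_error ::
  "nat \<Rightarrow> (real \<Rightarrow> real) set \<Rightarrow> ((real \<Rightarrow> real) \<Rightarrow> real)
    \<Rightarrow> ((real \<Rightarrow> real) \<Rightarrow> (real \<Rightarrow> real)) \<Rightarrow> (real \<Rightarrow> real) set
    \<Rightarrow> ((real \<Rightarrow> real) \<Rightarrow> (nat \<Rightarrow> real)) \<Rightarrow> (nat \<Rightarrow> real) set \<Rightarrow> ereal" where
  "optimal_error n Y N A W I U = (INF \<Phi>\<in>methods n Y. recovery_error n N A W I U \<Phi>)"

definition optimal_method ::
  "nat \<Rightarrow> (real \<Rightarrow> real) set \<Rightarrow> ((real \<Rightarrow> real) \<Rightarrow> real)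
    \<Rightarrow> ((real \<Rightarrow> real) \<Rightarrow> (real \<Rightarrow> real)) \<Rightarrow> (real \<Rightarrow> real) set
    \<Rightarrow> ((real \<Rightarrow> real) \<Rightarrow> (nat \<Rightarrow> real)) \<Rightarrow> (nat \<Rightarrow> real) set
    \<Rightarrow> ((nat \<Rightarrow> real) \<Rightarrow> (real \<Rightarrow> real)) \<Rightarrow> bool" where
  "optimal_method n Y N A W I U \<Phi> \<longleftrightarrow>
     \<Phi> \<in> methods n Y \<and> recovery_error n N A W I U \<Phi> = optimal_error n Y N A W I U"

definition tau :: "nat \<Rightarrow> (real \<Rightarrow> real) \<Rightarrow> (nat \<Rightarrow> real) \<Rightarrow> (nat \<Rightarrow> real) \<Rightarrow> real \<Rightarrow> real" where
  "tau n \<omega> q e t = Min ((\<lambda>j. e j + \<omega> \<bar>t - q j\<bar>) ` {1..n})"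

definition Pi_cell' ::
  "real \<Rightarrow> real \<Rightarrow> nat \<Rightarrow> (real \<Rightarrow> real) \<Rightarrow> (nat \<Rightarrow> real) \<Rightarrow> (nat \<Rightarrow> real) \<Rightarrow> nat \<Rightarrow> real set" where
  "Pi_cell' a b n \<omega> q e j = {t \<in> {a..b}. tau n \<omega> q e t = e j + \<omega> \<bar>t - q j\<bar>}"

fun Pi_cell ::
  "real \<Rightarrow> real \<Rightarrow> nat \<Rightarrow> (real \<Rightarrow> real) \<Rightarrow> (nat \<Rightarrow> real) \<Rightarrow> (nat \<Rightarrow> real) \<Rightarrow> nat \<Rightarrow> real set" where
  "Pi_cell a b n \<omega> q e j = Pi_cell' a b n \<omega> q e j - (\<Union>s\<in>{1..<j}. Pi_cell a b n \<omega> q e s)"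

declare Pi_cell.simps [simp del]

definition L_op ::
  "real \<Rightarrow> real \<Rightarrow> nat \<Rightarrow> (real \<Rightarrow> real) \<Rightarrow> (nat \<Rightarrow> real) \<Rightarrow> (nat \<Rightarrow> real)
    \<Rightarrow> (nat \<Rightarrow> real) \<Rightarrow> (real \<Rightarrow> real)" where
  "L_op a b n \<omega> q e z t = z (THE j. j \<in> {1..n} \<and> t \<in> Pi_cell a b n \<omega> q e j)"

text \<open>\<open>iter_kernel a b k n\<close> is the iterated kernel usually written \<open>k\<^sub>n\<^sub>+\<^sub>1\<close>.\<close>

primrec iter_kernel ::
  "real \<Rightarrow> real \<Rightarrow> (real \<Rightarrow> real \<Rightarrow> real) \<Rightarrow> nat \<Rightarrow> real \<Rightarrow> real \<Rightarrow> real" where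
  "iter_kernel a b k 0 = k"
| "iter_kernel a b k (Suc n) =
     (\<lambda>t s. LINT u|lebesgue_on {a..b}. iter_kernel a b k n t u * k u s)"

text \<open>
  The resolvent kernel is determined only up to a null set of the square, on which the series
  need not converge; \<open>\<Gamma>\<close> may be any representative.
\<close>

definition is_resolvent_kernel ::
  "real \<Rightarrow> real \<Rightarrow> (real \<Rightarrow> real \<Rightarrow> real) \<Rightarrow> (real \<Rightarrow> real \<Rightarrow> real) \<Rightarrow> bool" where
  "is_resolvent_kernel a b k \<Gamma> \<longleftrightarrow>
     (AE (t, s) in lebesgue_on ({a..b} \<times> {a..b}). \<Gamma> t s = (\<Sum>n. iter_kernel a b k n t s))"

definition fredholm_op ::
  "real \<Rightarrow> real \<Rightarrow> (real \<Rightarrow> real \<Rightarrow> real) \<Rightarrow> (real \<Rightarrow> real) \<Rightarrow> (real \<Rightarrow> real)" where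
  "fredholm_op a b \<Gamma> f = (\<lambda>t. f t + (LINT s|lebesgue_on {a..b}. \<Gamma> t s * f s))"

end

theory Submission
  imports Defs
begin

text \<open>
  For almost every \<open>t\<close>, repeated use of the Cauchy--Schwarz inequality bounds the \<open>n\<close>-th iterated
  kernel at \<open>(t, s)\<close> by \<open>\<parallel>k\<parallel>\<^sup>n\<^sup>-\<^sup>2 \<parallel>k(t, \<cdot>)\<parallel> \<parallel>k(\<cdot>, s)\<parallel>\<close> for \<open>n \<ge> 2\<close>, with \<open>L\<^sup>2\<close> norms and
  \<open>\<parallel>k\<parallel> < 1\<close>.  Hence the Neumann series converges almost everywhere, \<open>\<Gamma>(t, \<cdot>)\<close> is integrable, and it
  is non-negative, so \<open>A\<close> is a positive operator.  Since \<open>\<bar>x - L z\<bar> \<le> \<tau>\<close> for every \<open>x\<close> in the class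
  with noisy data \<open>z\<close>, positivity gives \<open>\<bar>A x - A L z\<bar> \<le> A \<tau>\<close>.  Conversely \<open>\<tau>\<close> and \<open>- \<tau>\<close> both lie in
  the class and both admit the data \<open>0\<close>, so no method has error below \<open>\<parallel>A \<tau>\<parallel>\<close>.
\<close>

section \<open>Measurability and null sets on the square\<close>

lemma finite_measure_interval: "finite_measure (lebesgue_on {a..b::real})"
  by (metis cbox_interval finite_measure_lebesgue_on lmeasurable_cbox)

lemma pair_sigma_finite_interval:
  "pair_sigma_finite (lebesgue_on {a..b::real}) (lebesgue_on {c..d::real})"
  by (simp add: finite_measure.axioms(1) finite_measure_interval pair_sigma_finite_def)

text \<open>Completeness of Lebesgue measure. It supplies measurability for the sections of
  \<open>\<Gamma>\<close>, which may be any representative, and for integrands built from the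
  original kernel.\<close>

lemma measurable_lebesgue_on_AE:
  fixes f g :: "real \<Rightarrow> real"
  assumes "f \<in> borel_measurable (lebesgue_on {a..b})"
    and "AE t in lebesgue_on {a..b}. f t = g t"
  shows "g \<in> borel_measurable (lebesgue_on {a..b})"
proof (rule borel_measurable_if_D)
  have "AE t in lebesgue. (if t \<in> {a..b} then f t else 0) = (if t \<in> {a..b} then g t else 0)"
    using assms(2) by (simp add: AE_restrict_space_iff)
  then show "(\<lambda>t. if t \<in> {a..b} then g t else 0) \<in> borel_measurable lebesgue"
    using borel_measurable_AE[OF borel_measurable_if_I[OF assms(1)]] by simp
qed

text \<open>Lebesgue measure on the plane is the completion of the product
  \<open>lborel \<Otimes>\<^sub>M lborel\<close>, so a property that holds almost everywhere for one
  does so for the other, and Fubini then gives the rows. Swapping the coordinates preserves the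
  product and gives the columns.\<close>

lemma AE_lebesgue_square:
  fixes P :: "real \<Rightarrow> real \<Rightarrow> bool"
  assumes "AE (t, s) in lebesgue_on ({a..b} \<times> {a..b}). P t s"
  shows "AE t in lebesgue_on {a..b}. AE s in lebesgue_on {a..b}. P t s"
    and "AE s in lebesgue_on {a..b}. AE t in lebesgue_on {a..b}. P t s"
proof -
  have sq: "{a..b} \<times> {a..b} \<in> sets (lebesgue :: (real \<times> real) measure)"
    by (intro sets_completionI_sets) (simp add: borel_closed closed_Times)
  have "AE p in lebesgue. p \<in> {a..b} \<times> {a..b} \<longrightarrow> P (fst p) (snd p)"
    using assms sq by (simp add: AE_restrict_space_iff case_prod_beta)
  then have *: "AE p in lborel \<Otimes>\<^sub>M lborel. p \<in> {a..b} \<times> {a..b} \<longrightarrow> P (fst p) (snd p)"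
    unfolding lborel_prod by (simp only: AE_completion_iff)
  then have **: "AE p in lborel \<Otimes>\<^sub>M lborel. prod.swap p \<in> {a..b} \<times> {a..b} \<longrightarrow> P (snd p) (fst p)"
    by (subst (asm) lborel_pair.distr_pair_swap)
      (auto dest!: AE_distrD[rotated] simp: case_prod_beta)
  show "AE t in lebesgue_on {a..b}. AE s in lebesgue_on {a..b}. P t s"
    using lborel_pair.AE_pair[OF *]
    by (simp add: AE_restrict_space_iff AE_completion_iff) (auto elim!: eventually_mono)
  show "AE s in lebesgue_on {a..b}. AE t in lebesgue_on {a..b}. P t s"
    using lborel_pair.AE_pair[OF **]
    by (simp add: AE_restrict_space_iff AE_completion_iff) (auto elim!: eventually_mono)
qed

section \<open>Convergence of the Neumann series\<close>

text \<open>The product is integrable because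
  \<open>\<bar>u * v\<bar> \<le> u\<^sup>2 + v\<^sup>2\<close>, so the extended non-negative
  version, applied to absolute values, can be read back as an inequality of real numbers.\<close>

lemma Cauchy_Schwarz_integral:
  fixes f g :: "'a \<Rightarrow> real"
  assumes [measurable]: "f \<in> borel_measurable M" "g \<in> borel_measurable M"
    and f2: "integrable M (\<lambda>x. (f x)\<^sup>2)" and g2: "integrable M (\<lambda>x. (g x)\<^sup>2)"
  shows "(LINT x|M. f x * g x)\<^sup>2 \<le> (LINT x|M. (f x)\<^sup>2) * (LINT x|M. (g x)\<^sup>2)"
proof -
  have fg: "integrable M (\<lambda>x. f x * g x)"
  proof (rule Bochner_Integration.integrable_bound[OF Bochner_Integration.integrable_add[OF f2 g2]])
    have "\<bar>u * v\<bar> \<le> u\<^sup>2 + v\<^sup>2" for u v :: real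
      using sum_squares_bound[of "\<bar>u\<bar>" "\<bar>v\<bar>"] abs_ge_zero[of "u * v"]
      unfolding abs_mult power2_abs by linarith
    then show "AE x in M. norm (f x * g x) \<le> norm ((f x)\<^sup>2 + (g x)\<^sup>2)"
      by simp
  qed simp
  have "(ennreal (LINT x|M. \<bar>f x * g x\<bar>))\<^sup>2
      = (\<integral>\<^sup>+x. ennreal \<bar>f x\<bar> * ennreal \<bar>g x\<bar> \<partial>M)\<^sup>2"
    using nn_integral_eq_integral[OF integrable_abs[OF fg]] by (simp add: abs_mult ennreal_mult)
  also have "\<dots> \<le> (\<integral>\<^sup>+x. (ennreal \<bar>f x\<bar>)\<^sup>2 \<partial>M) * (\<integral>\<^sup>+x. (ennreal \<bar>g x\<bar>)\<^sup>2 \<partial>M)"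
    by (rule Cauchy_Schwarz_nn_integral) auto
  also have "\<dots> = ennreal (LINT x|M. (f x)\<^sup>2) * ennreal (LINT x|M. (g x)\<^sup>2)"
    using f2 g2 by (simp add: ennreal_power nn_integral_eq_integral)
  finally have "(LINT x|M. \<bar>f x * g x\<bar>)\<^sup>2 \<le> (LINT x|M. (f x)\<^sup>2) * (LINT x|M. (g x)\<^sup>2)"
    by (simp add: ennreal_power ennreal_mult[symmetric])
  moreover have "\<bar>LINT x|M. f x * g x\<bar>\<^sup>2 \<le> (LINT x|M. \<bar>f x * g x\<bar>)\<^sup>2"
    by (rule power_mono[OF integral_abs_bound]) simp
  ultimately show ?thesis
    unfolding power2_abs by linarith
qed

lemma iter_kernel_measurable:
  assumes "case_prod k \<in> borel_measurable (lebesgue_on {a..b} \<Otimes>\<^sub>M lebesgue_on {a..b})"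
  shows "case_prod (iter_kernel a b k n)
    \<in> borel_measurable (lebesgue_on {a..b} \<Otimes>\<^sub>M lebesgue_on {a..b})"
proof (induction n)
  case 0
  then show ?case using assms by simp
next
  case (Suc n)
  interpret finite_measure "lebesgue_on {a..b}" by (rule finite_measure_interval)
  note [measurable] = Suc assms
  have "(\<lambda>p. LINT u|lebesgue_on {a..b}. iter_kernel a b k n (fst p) u * k u (snd p))
      \<in> borel_measurable (lebesgue_on {a..b} \<Otimes>\<^sub>M lebesgue_on {a..b})"
    by measurable
  then show ?case by (simp add: case_prod_beta')
qed

lemma section_measurable:
  assumes "case_prod k \<in> borel_measurable (M1 \<Otimes>\<^sub>M M2)"
  shows "t \<in> space M1 \<Longrightarrow> k t \<in> borel_measurable M2"
    and "s \<in> space M2 \<Longrightarrow> (\<lambda>u. k u s) \<in> borel_measurable M1"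
  using measurable_Pair2[OF assms, of t] measurable_Pair1[OF assms, of s] by simp_all

text \<open>Measurability is asked for the product sigma-algebra: there every section is measurable
  and integrating out a variable preserves measurability, so all iterated kernels remain in this
  setting. A kernel measurable only on the Lebesgue square is first replaced by a representative of
  this kind.\<close>

locale contractive_kernel =
  fixes a b :: real and k :: "real \<Rightarrow> real \<Rightarrow> real"
  assumes k_measurable [measurable]:
    "case_prod k \<in> borel_measurable (lebesgue_on {a..b} \<Otimes>\<^sub>M lebesgue_on {a..b})"
    and k_small:
    "(\<integral>\<^sup>+ s. (\<integral>\<^sup>+ t. ennreal (\<bar>k t s\<bar>\<^sup>2) \<partial>lebesgue_on {a..b}) \<partial>lebesgue_on {a..b}) < 1"
begin

abbreviation "M \<equiv> lebesgue_on {a..b}"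

sublocale finite_measure M by (rule finite_measure_interval)
sublocale MM: pair_sigma_finite M M by (rule pair_sigma_finite_interval)

text \<open>The squared \<open>L\<^sup>2\<close> norm of the column \<open>k(\<cdot>, s)\<close>;
  \<open>total_sq\<close> is the squared Hilbert-Schmidt norm of the kernel. On the null set of
  columns that are not square integrable the integral has its default value 0.\<close>

definition "column_sq s = (LINT u|M. (k u s)\<^sup>2)"
definition "total_sq = (LINT s|M. column_sq s)"

lemma k2_integrable: "integrable (M \<Otimes>\<^sub>M M) (\<lambda>(t, s). (k t s)\<^sup>2)"
proof (rule integrableI_bounded)
  have "(\<integral>\<^sup>+ p. ennreal (norm (case p of (t, s) \<Rightarrow> (k t s)\<^sup>2)) \<partial>(M \<Otimes>\<^sub>M M))
      = (\<integral>\<^sup>+ s. (\<integral>\<^sup>+ t. ennreal (\<bar>k t s\<bar>\<^sup>2) \<partial>M) \<partial>M)"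
    by (subst MM.nn_integral_snd[symmetric]) auto
  also have "\<dots> < \<infinity>"
    using order.strict_trans[OF k_small ennreal_one_less_top] by (simp only: infinity_ennreal_def)
  finally show "(\<integral>\<^sup>+ p. ennreal (norm (case p of (t, s) \<Rightarrow> (k t s)\<^sup>2)) \<partial>(M \<Otimes>\<^sub>M M)) < \<infinity>" .
qed simp

lemma AE_integrable_row: "AE t in M. integrable M (\<lambda>s. (k t s)\<^sup>2)"
  using MM.AE_integrable_fst'[OF k2_integrable] by simp

lemma AE_integrable_column: "AE s in M. integrable M (\<lambda>t. (k t s)\<^sup>2)"
  using MM.AE_integrable_fst'[OF MM.integrable_product_swap[OF k2_integrable]] by simp

lemma column_sq_integrable: "integrable M column_sq"
  using MM.integrable_fst'[OF MM.integrable_product_swap[OF k2_integrable]]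
  by (simp add: column_sq_def[abs_def])

lemma column_sq_nonneg: "0 \<le> column_sq s"
  by (simp add: column_sq_def)

lemma total_sq_nonneg: "0 \<le> total_sq"
  by (simp add: total_sq_def column_sq_nonneg)

lemma total_sq_less_1: "total_sq < 1"
proof -
  have "ennreal total_sq = (\<integral>\<^sup>+ s. ennreal (column_sq s) \<partial>M)"
    by (simp add: total_sq_def nn_integral_eq_integral column_sq_integrable column_sq_nonneg)
  also have "\<dots> = (\<integral>\<^sup>+ s. (\<integral>\<^sup>+ t. ennreal (\<bar>k t s\<bar>\<^sup>2) \<partial>M) \<partial>M)"
    using AE_integrable_column
    by (intro nn_integral_cong_AE) (auto simp: column_sq_def nn_integral_eq_integral elim!: eventually_mono)
  also note k_small
  finally show ?thesis
    by simp
qed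

text \<open>Cauchy-Schwarz in the integral that defines the next iterate, with \<open>t\<close>
  fixed. The exceptional \<open>s\<close> are those whose column is not square integrable.\<close>

lemma iter_step:
  assumes "t \<in> {a..b}" "integrable M (\<lambda>u. (iter_kernel a b k n t u)\<^sup>2)"
  shows "AE s in M. (iter_kernel a b k (Suc n) t s)\<^sup>2
      \<le> (LINT u|M. (iter_kernel a b k n t u)\<^sup>2) * column_sq s"
proof -
  have "iter_kernel a b k n t \<in> borel_measurable M"
    using section_measurable(1)[OF iter_kernel_measurable[OF k_measurable]] assms(1) by simp
  then have "(iter_kernel a b k (Suc n) t s)\<^sup>2 \<le> (LINT u|M. (iter_kernel a b k n t u)\<^sup>2) * column_sq s"
    if "s \<in> space M" "integrable M (\<lambda>u. (k u s)\<^sup>2)" for s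
    using Cauchy_Schwarz_integral[OF _ section_measurable(2)[OF k_measurable that(1)] assms(2) that(2)]
    by (simp add: column_sq_def)
  then show ?thesis
    using AE_integrable_column AE_space by (auto elim!: eventually_elim2)
qed

text \<open>Integrating the bound of \<open>iter_step\<close> over \<open>s\<close> turns
  \<open>column_sq\<close> into \<open>total_sq\<close>, so each iteration contributes one such
  factor. The condition on \<open>t\<close> concerns the row of \<open>k\<close> alone, so one null
  set of \<open>t\<close> serves all iterates.\<close>

lemma iter_square_integrable:
  assumes t: "t \<in> {a..b}" and row: "integrable M (\<lambda>s. (k t s)\<^sup>2)"
  shows "integrable M (\<lambda>s. (iter_kernel a b k n t s)\<^sup>2)
    \<and> (LINT s|M. (iter_kernel a b k n t s)\<^sup>2) \<le> total_sq ^ n * (LINT s|M. (k t s)\<^sup>2)"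
proof (induction n)
  case 0
  then show ?case using row by simp
next
  case (Suc n)
  let ?R = "LINT u|M. (iter_kernel a b k n t u)\<^sup>2"
  have [measurable]: "iter_kernel a b k (Suc n) t \<in> borel_measurable M"
    using section_measurable(1)[OF iter_kernel_measurable[OF k_measurable], of t "Suc n"] t by simp
  have step: "AE s in M. (iter_kernel a b k (Suc n) t s)\<^sup>2 \<le> ?R * column_sq s"
    using iter_step t Suc by blast
  have RC: "integrable M (\<lambda>s. ?R * column_sq s)"
    using column_sq_integrable by simp
  have int: "integrable M (\<lambda>s. (iter_kernel a b k (Suc n) t s)\<^sup>2)"
    using step by (intro Bochner_Integration.integrable_bound[OF RC]) (auto elim!: eventually_mono simp del: iter_kernel.simps)
  have "(LINT s|M. (iter_kernel a b k (Suc n) t s)\<^sup>2) \<le> (LINT s|M. ?R * column_sq s)"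
    by (rule integral_mono_AE[OF int RC step])
  also have "\<dots> = ?R * total_sq"
    by (simp add: total_sq_def)
  also have "\<dots> \<le> (total_sq ^ n * (LINT s|M. (k t s)\<^sup>2)) * total_sq"
    using Suc total_sq_nonneg by (intro mult_right_mono) auto
  finally show ?case
    using int by (simp add: mult_ac)
qed

text \<open>The previous two estimates combined. They start at \<open>Suc n\<close> because
  Cauchy-Schwarz needs one integration: the values of \<open>k\<close> itself are not controlled by
  norms of its rows and columns.\<close>

lemma iter_bound:
  assumes t: "t \<in> {a..b}" and row: "integrable M (\<lambda>s. (k t s)\<^sup>2)"
  shows "AE s in M. \<forall>n. \<bar>iter_kernel a b k (Suc n) t s\<bar>
      \<le> sqrt total_sq ^ n * sqrt ((LINT s|M. (k t s)\<^sup>2) * column_sq s)"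
proof (subst AE_all_countable, rule allI)
  fix n
  let ?R = "LINT s|M. (k t s)\<^sup>2"
  show "AE s in M. \<bar>iter_kernel a b k (Suc n) t s\<bar> \<le> sqrt total_sq ^ n * sqrt (?R * column_sq s)"
    using iter_step[OF t conjunct1[OF iter_square_integrable[OF t row]], of n]
  proof (rule eventually_mono)
    fix s
    assume "(iter_kernel a b k (Suc n) t s)\<^sup>2
      \<le> (LINT u|M. (iter_kernel a b k n t u)\<^sup>2) * column_sq s"
    also have "\<dots> \<le> total_sq ^ n * ?R * column_sq s"
      using iter_square_integrable[OF t row, of n] column_sq_nonneg by (intro mult_right_mono) auto
    finally have "sqrt ((iter_kernel a b k (Suc n) t s)\<^sup>2) \<le> sqrt (total_sq ^ n * ?R * column_sq s)"
      by (rule real_sqrt_le_mono)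
    then show "\<bar>iter_kernel a b k (Suc n) t s\<bar> \<le> sqrt total_sq ^ n * sqrt (?R * column_sq s)"
      unfolding real_sqrt_abs by (simp only: real_sqrt_mult real_sqrt_power mult.assoc)
  qed
qed

lemma resolvent_row:
  "AE t in M. (AE s in M. summable (\<lambda>n. iter_kernel a b k n t s))
    \<and> integrable M (\<lambda>s. \<Sum>n. iter_kernel a b k n t s)"
  using AE_integrable_row AE_space
proof (rule eventually_elim2)
  fix t
  assume row: "integrable M (\<lambda>s. (k t s)\<^sup>2)" and "t \<in> space M"
  then have t: "t \<in> {a..b}" by simp
  let ?h = "\<lambda>s n. iter_kernel a b k n t s"
  let ?R = "LINT s|M. (k t s)\<^sup>2"
  \<comment> \<open>An integrable majorant of the whole series: \<open>1 + (k t s)\<^sup>2\<close>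
    dominates the leading term, and the quotient dominates the geometric sum of the others, after
    \<open>sqrt y \<le> 1 + y\<close> has removed the root.\<close>
  let ?D = "\<lambda>s. 1 + (k t s)\<^sup>2 + (1 + ?R * column_sq s) / (1 - sqrt total_sq)"
  have [measurable]: "(\<lambda>s. ?h s n) \<in> borel_measurable M" for n
    using section_measurable(1)[OF iter_kernel_measurable[OF k_measurable], of t n] t by simp
  have rt: "0 \<le> sqrt total_sq" "sqrt total_sq < 1"
    using total_sq_nonneg total_sq_less_1 by auto
  have *: "summable (?h s) \<and> norm (\<Sum>n. ?h s n) \<le> norm (?D s)"
    if bd: "\<forall>n. \<bar>?h s (Suc n)\<bar> \<le> sqrt total_sq ^ n * sqrt (?R * column_sq s)" for s
  proof -
    let ?g = "\<lambda>n. sqrt total_sq ^ n * sqrt (?R * column_sq s)"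
    have g: "?g sums (1 / (1 - sqrt total_sq) * sqrt (?R * column_sq s))"
      using rt by (intro sums_mult2 geometric_sums) simp
    have sum: "summable (\<lambda>n. norm (?h s (Suc n)))"
      using bd by (intro summable_comparison_test'[OF sums_summable[OF g], of 0]) auto
    then have "summable (\<lambda>n. ?h s (Suc n))"
      by (rule summable_norm_cancel)
    then have sh: "summable (?h s)"
      using summable_Suc_iff[of "?h s"] by (simp del: iter_kernel.simps)
    have "norm (\<Sum>n. ?h s (Suc n)) \<le> (\<Sum>n. norm (?h s (Suc n)))"
      by (rule summable_norm[OF sum])
    also have "\<dots> \<le> (\<Sum>n. ?g n)"
      using bd by (intro suminf_le[OF _ sum sums_summable[OF g]]) auto
    also have "\<dots> = sqrt (?R * column_sq s) / (1 - sqrt total_sq)"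
      using sums_unique[OF g] by simp
    also have "\<dots> \<le> (1 + ?R * column_sq s) / (1 - sqrt total_sq)"
    proof (rule divide_right_mono)
      have "sqrt y \<le> 1 + y" if "0 \<le> y" for y :: real
        using that by (intro real_le_lsqrt) (simp_all add: power2_sum)
      then show "sqrt (?R * column_sq s) \<le> 1 + ?R * column_sq s"
        by (simp add: column_sq_nonneg)
    qed (use rt in simp)
    finally have tail: "norm (\<Sum>n. ?h s (Suc n)) \<le> (1 + ?R * column_sq s) / (1 - sqrt total_sq)" .
    have "\<bar>k t s\<bar> \<le> 1 + (k t s)\<^sup>2"
      using sum_squares_bound[of "\<bar>k t s\<bar>" 1] by simp
    moreover have "(\<Sum>n. ?h s n) = (\<Sum>n. ?h s (Suc n)) + k t s"
      using suminf_split_head[OF sh] by simp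
    ultimately have "norm (\<Sum>n. ?h s n) \<le> ?D s"
      using tail by (simp del: iter_kernel.simps(2))
    then show ?thesis
      using sh by (simp del: iter_kernel.simps)
  qed
  have D: "integrable M ?D"
    using row column_sq_integrable by (auto simp: integrable_const)
  show "(AE s in M. summable (?h s)) \<and> integrable M (\<lambda>s. \<Sum>n. ?h s n)"
  proof
    show "AE s in M. summable (?h s)"
      using iter_bound[OF t row] * by (auto elim!: eventually_mono)
    show "integrable M (\<lambda>s. \<Sum>n. ?h s n)"
      using iter_bound[OF t row] *
      by (intro Bochner_Integration.integrable_bound[OF D]) (auto elim!: eventually_mono)
  qed
qed

end

section \<open>Transfer to almost everywhere equal kernels\<close>

text \<open>The induction hypothesis is used along the row at \<open>t\<close> and the equality of
  the kernels along the column at \<open>s\<close>, so null sets are kept as iterated "almost every"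
  statements. Integrands with \<open>k\<close> get their measurability from those with
  \<open>k'\<close>.\<close>

lemma iter_kernel_cong_AE:
  assumes rows: "AE t in lebesgue_on {a..b}. AE s in lebesgue_on {a..b}. k t s = k' t s"
    and columns: "AE s in lebesgue_on {a..b}. AE t in lebesgue_on {a..b}. k t s = k' t s"
    and k': "case_prod k' \<in> borel_measurable (lebesgue_on {a..b} \<Otimes>\<^sub>M lebesgue_on {a..b})"
  shows "AE t in lebesgue_on {a..b}. AE s in lebesgue_on {a..b}.
    iter_kernel a b k n t s = iter_kernel a b k' n t s"
proof (induction n)
  case 0
  then show ?case using rows by simp
next
  case (Suc n)
  let ?M = "lebesgue_on {a..b}"
  show ?case
    using Suc AE_space
  proof (rule eventually_elim2)
    fix t
    assume t: "t \<in> space ?M"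
      and eq: "AE u in ?M. iter_kernel a b k n t u = iter_kernel a b k' n t u"
    show "AE s in ?M. iter_kernel a b k (Suc n) t s = iter_kernel a b k' (Suc n) t s"
      using columns AE_space
    proof (rule eventually_elim2)
      fix s
      assume s: "s \<in> space ?M" and ks: "AE u in ?M. k u s = k' u s"
      have m: "(\<lambda>u. iter_kernel a b k' n t u * k' u s) \<in> borel_measurable ?M"
        using section_measurable(1)[OF iter_kernel_measurable[OF k'] t]
          section_measurable(2)[OF k' s] by simp
      have ae: "AE u in ?M. iter_kernel a b k' n t u * k' u s = iter_kernel a b k n t u * k u s"
        using eq ks by (rule eventually_elim2) simp
      show "iter_kernel a b k (Suc n) t s = iter_kernel a b k' (Suc n) t s"
        using integral_cong_AE[OF m measurable_lebesgue_on_AE[OF m ae] ae] by simp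
    qed
  qed
qed

text \<open>The integral of an almost everywhere non-negative function is non-negative, even where
  it takes the default value 0. Hence the induction can run on \<open>k\<close> itself.\<close>

lemma iter_kernel_nonneg_AE:
  assumes rows: "AE t in lebesgue_on {a..b}. AE s in lebesgue_on {a..b}. 0 \<le> k t s"
    and columns: "AE s in lebesgue_on {a..b}. AE t in lebesgue_on {a..b}. 0 \<le> k t s"
  shows "AE t in lebesgue_on {a..b}. AE s in lebesgue_on {a..b}. 0 \<le> iter_kernel a b k n t s"
proof (induction n)
  case 0
  then show ?case using rows by simp
next
  case (Suc n)
  then show ?case
  proof (rule eventually_mono)
    fix t
    assume pos: "AE u in lebesgue_on {a..b}. 0 \<le> iter_kernel a b k n t u"
    show "AE s in lebesgue_on {a..b}. 0 \<le> iter_kernel a b k (Suc n) t s"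
      using columns
    proof (rule eventually_mono)
      fix s
      assume "AE u in lebesgue_on {a..b}. 0 \<le> k u s"
      with pos have "AE u in lebesgue_on {a..b}. 0 \<le> iter_kernel a b k n t u * k u s"
        by (rule eventually_elim2) simp
      then show "0 \<le> iter_kernel a b k (Suc n) t s"
        by (simp add: integral_nonneg_AE)
    qed
  qed
qed

text \<open>The extension of \<open>k\<close> by 0 agrees almost everywhere with a Borel function on
  the plane. A Borel function is measurable for the product of the Borel sigma-algebras, hence for
  the product of the larger Lebesgue ones.\<close>

lemma lebesgue_square_Borel_representative:
  assumes "case_prod k \<in> borel_measurable (lebesgue_on ({a..b} \<times> {a..b::real}))"
  obtains k' :: "real \<Rightarrow> real \<Rightarrow> real"
  where "case_prod k' \<in> borel_measurable (lebesgue_on {a..b} \<Otimes>\<^sub>M lebesgue_on {a..b})"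
    and "AE (t, s) in lebesgue_on ({a..b} \<times> {a..b}). k t s = k' t s"
proof -
  let ?S = "{a..b} \<times> {a..b}"
  have sq: "?S \<in> sets (lebesgue :: (real \<times> real) measure)"
    by (intro sets_completionI_sets) (simp add: borel_closed closed_Times)
  obtain g where g: "g \<in> borel_measurable lborel"
    and ae: "AE p in lborel. (if p \<in> ?S then case_prod k p else 0) = g p"
    using completion_ex_borel_measurable_real[OF borel_measurable_if_I[OF assms sq]] by blast
  have "(\<lambda>p. p) \<in> lebesgue_on {a..b} \<Otimes>\<^sub>M lebesgue_on {a..b} \<rightarrow>\<^sub>M borel \<Otimes>\<^sub>M borel"
  proof (rule measurable_pair)
    have id: "(\<lambda>x. x) \<in> lebesgue_on {a..b} \<rightarrow>\<^sub>M borel"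
      by (intro measurable_restrict_space1 measurable_completion) simp
    show "fst \<circ> (\<lambda>p. p) \<in> lebesgue_on {a..b} \<Otimes>\<^sub>M lebesgue_on {a..b} \<rightarrow>\<^sub>M borel"
      using measurable_compose[OF measurable_fst id] by (simp only: comp_def)
    show "snd \<circ> (\<lambda>p. p) \<in> lebesgue_on {a..b} \<Otimes>\<^sub>M lebesgue_on {a..b} \<rightarrow>\<^sub>M borel"
      using measurable_compose[OF measurable_snd id] by (simp only: comp_def)
  qed
  then have "g \<in> borel_measurable (lebesgue_on {a..b} \<Otimes>\<^sub>M lebesgue_on {a..b})"
    using measurable_compose[of "\<lambda>p. p" _ "borel \<Otimes>\<^sub>M borel" g] g by (simp add: borel_prod)
  moreover have "AE p in lebesgue_on ?S. case_prod k p = g p"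
    using AE_completion[OF ae] sq by (simp add: AE_restrict_space_iff) (auto elim!: eventually_mono)
  ultimately show thesis
    using that[of "curry g"] by (simp add: case_prod_beta')
qed

text \<open>Everything the recovery argument needs to know about \<open>\<Gamma>\<close>.
  Convergence and integrability come from the representative \<open>k'\<close>, the sign from
  \<open>k\<close>; on almost every row both series agree with \<open>\<Gamma>\<close>.\<close>

lemma resolvent_kernel_nonneg_integrable:
  assumes k: "case_prod k \<in> borel_measurable (lebesgue_on ({a..b} \<times> {a..b}))"
    and small: "(\<integral>\<^sup>+ s. (\<integral>\<^sup>+ t. ennreal (\<bar>k t s\<bar>\<^sup>2) \<partial>lebesgue_on {a..b}) \<partial>lebesgue_on {a..b}) < 1"
    and res: "is_resolvent_kernel a b k \<Gamma>"
    and nonneg: "AE (t, s) in lebesgue_on ({a..b} \<times> {a..b}). 0 \<le> k t s"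
  shows "AE t in lebesgue_on {a..b}.
    (AE s in lebesgue_on {a..b}. 0 \<le> \<Gamma> t s) \<and> integrable (lebesgue_on {a..b}) (\<Gamma> t)"
proof -
  let ?M = "lebesgue_on {a..b}"
  obtain k' where k': "case_prod k' \<in> borel_measurable (?M \<Otimes>\<^sub>M ?M)"
    and eq: "AE (t, s) in lebesgue_on ({a..b} \<times> {a..b}). k t s = k' t s"
    using lebesgue_square_Borel_representative[OF k] .
  have "(\<integral>\<^sup>+ s. (\<integral>\<^sup>+ t. ennreal (\<bar>k' t s\<bar>\<^sup>2) \<partial>?M) \<partial>?M)
      = (\<integral>\<^sup>+ s. (\<integral>\<^sup>+ t. ennreal (\<bar>k t s\<bar>\<^sup>2) \<partial>?M) \<partial>?M)"
    using AE_lebesgue_square(2)[OF eq]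
    by (auto intro!: nn_integral_cong_AE elim!: eventually_mono)
  then interpret k': contractive_kernel a b k'
    using k' small by unfold_locales simp_all
  have iter_eq: "AE t in ?M. \<forall>n. AE s in ?M. iter_kernel a b k n t s = iter_kernel a b k' n t s"
    using iter_kernel_cong_AE[OF AE_lebesgue_square[OF eq] k'] by (simp add: AE_all_countable)
  have iter_pos: "AE t in ?M. \<forall>n. AE s in ?M. 0 \<le> iter_kernel a b k n t s"
    using iter_kernel_nonneg_AE[OF AE_lebesgue_square[OF nonneg]] by (simp add: AE_all_countable)
  have \<Gamma>: "AE t in ?M. AE s in ?M. \<Gamma> t s = (\<Sum>n. iter_kernel a b k n t s)"
    using AE_lebesgue_square(1)[OF res[unfolded is_resolvent_kernel_def]] .
  show ?thesis
    using iter_eq iter_pos \<Gamma> k'.resolvent_row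
  proof eventually_elim
    case (elim t)
    let ?G = "\<lambda>s. \<Sum>n. iter_kernel a b k' n t s"
    have eq: "AE s in ?M. \<forall>n. iter_kernel a b k n t s = iter_kernel a b k' n t s"
      using elim(1) by (simp add: AE_all_countable)
    have pos: "AE s in ?M. \<forall>n. 0 \<le> iter_kernel a b k n t s"
      using elim(2) by (simp add: AE_all_countable)
    have G: "AE s in ?M. ?G s = \<Gamma> t s"
      using eq elim(3) by eventually_elim simp
    \<comment> \<open>Summability has to enter here: non-negative terms say nothing about
      \<open>suminf\<close> of a divergent series, whose value is unspecified.\<close>
    have "AE s in ?M. 0 \<le> \<Gamma> t s"
      using eq pos G conjunct1[OF elim(4)]
    proof eventually_elim
      case (elim s)
      then show ?case
        using suminf_nonneg[of "\<lambda>n. iter_kernel a b k' n t s"] by auto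
    qed
    moreover have "integrable ?M (\<Gamma> t)"
    proof (rule integrable_cong_AE_imp[OF conjunct2[OF elim(4)] _ G])
      show "\<Gamma> t \<in> borel_measurable ?M"
        using borel_measurable_integrable[OF conjunct2[OF elim(4)]] G
        by (rule measurable_lebesgue_on_AE)
    qed
    ultimately show ?case by simp
  qed
qed

section \<open>Optimal recovery\<close>

lemma normed_lattice_diff:
  assumes Y: "normed_lattice a b Y N" and f: "f \<in> Y" and g: "g \<in> Y"
  shows "(\<lambda>t. f t - g t) \<in> Y"
proof -
  have add: "\<forall>f\<in>Y. \<forall>g\<in>Y. (\<lambda>t. f t + g t) \<in> Y" and scale: "\<forall>c. \<forall>f\<in>Y. (\<lambda>t. c * f t) \<in> Y"
    using Y by (simp_all add: normed_lattice_def)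
  show ?thesis
    using bspec[OF bspec[OF add f] bspec[OF spec[OF scale, of "-1"] g]] by simp
qed

text \<open>The modulus in \<open>Y\<close> is an abstract join, not known to be the pointwise one.
  Still, \<open>g\<close> is an upper bound in \<open>Y\<close> of \<open>f\<close> and
  \<open>- f\<close>, so the modulus of \<open>f\<close> lies below \<open>g\<close>, which lies
  below its own modulus.\<close>

lemma normed_lattice_mono:
  assumes Y: "normed_lattice a b Y N" and "f \<in> Y" "g \<in> Y"
    and le: "AE t in lebesgue_on {a..b}. \<bar>f t\<bar> \<le> g t"
  shows "N f \<le> N g"
proof -
  interpret L: weak_lattice "ae_order a b Y"
    using Y by (simp add: normed_lattice_def)
  have carrier: "carrier (ae_order a b Y) = Y" and order: "le (ae_order a b Y) = ae_le a b"
    by (simp_all add: ae_order_def)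
  have minus: "(\<lambda>t. - h t) \<in> Y" if "h \<in> Y" for h
    using normed_lattice_diff[OF Y _ that, of "\<lambda>t. 0"] Y by (simp add: normed_lattice_def)
  have "ae_le a b (lattice_abs a b Y f) g"
  proof -
    have "ae_le a b f g" "ae_le a b (\<lambda>t. - f t) g"
      using le by (auto simp: ae_le_def elim!: eventually_mono)
    then show ?thesis
      using L.join_le[of f g "\<lambda>t. - f t"] assms(2,3) minus
      by (simp add: carrier order lattice_abs_def)
  qed
  moreover have "ae_le a b g (lattice_abs a b Y g)"
    using L.join_left[of g "\<lambda>t. - g t"] assms(3) minus
    by (simp add: carrier order lattice_abs_def)
  ultimately have "ae_le a b (lattice_abs a b Y f) (lattice_abs a b Y g)"
    unfolding ae_le_def by eventually_elim simp
  then show ?thesis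
    using Y assms(2,3) by (simp add: normed_lattice_def)
qed

lemma ess_bounded_integrable_mult:
  assumes "g \<in> ess_bounded a b" and K: "integrable (lebesgue_on {a..b}) K"
  shows "integrable (lebesgue_on {a..b}) (\<lambda>s. K s * g s)"
proof -
  obtain c where g: "g \<in> borel_measurable (lebesgue_on {a..b})"
    and c: "AE s in lebesgue_on {a..b}. \<bar>g s\<bar> \<le> c"
    using assms(1) by (auto simp: ess_bounded_def meas_fun_def)
  show ?thesis
  proof (rule Bochner_Integration.integrable_bound)
    show "integrable (lebesgue_on {a..b}) (\<lambda>s. c * K s)"
      using K by simp
    show "(\<lambda>s. K s * g s) \<in> borel_measurable (lebesgue_on {a..b})"
      using borel_measurable_integrable[OF K] g by simp
    show "AE s in lebesgue_on {a..b}. norm (K s * g s) \<le> norm (c * K s)"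
      using c
    proof eventually_elim
      case (elim s)
      then have "\<bar>K s\<bar> * \<bar>g s\<bar> \<le> \<bar>K s\<bar> * \<bar>c\<bar>"
        by (intro mult_left_mono) auto
      then show ?case by (simp add: abs_mult mult.commute)
    qed
  qed
qed

text \<open>Positivity of the operator in the form needed for the upper bound: a non-negative kernel
  preserves a pointwise domination under the integral.\<close>

lemma fredholm_op_dominated:
  assumes \<Gamma>: "AE t in lebesgue_on {a..b}.
      (AE s in lebesgue_on {a..b}. 0 \<le> \<Gamma> t s) \<and> integrable (lebesgue_on {a..b}) (\<Gamma> t)"
    and eb: "f \<in> ess_bounded a b" "g \<in> ess_bounded a b" "h \<in> ess_bounded a b"
    and le: "\<And>t. t \<in> {a..b} \<Longrightarrow> \<bar>f t - g t\<bar> \<le> h t"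
  shows "AE t in lebesgue_on {a..b}.
    \<bar>fredholm_op a b \<Gamma> f t - fredholm_op a b \<Gamma> g t\<bar> \<le> fredholm_op a b \<Gamma> h t"
  using \<Gamma> AE_space
proof eventually_elim
  case (elim t)
  let ?M = "lebesgue_on {a..b}"
  have pos: "AE s in ?M. 0 \<le> \<Gamma> t s" and int: "integrable ?M (\<Gamma> t)"
    using elim by auto
  note [simp] = eb[THEN ess_bounded_integrable_mult, OF int]
  have "\<bar>(LINT s|?M. \<Gamma> t s * f s) - (LINT s|?M. \<Gamma> t s * g s)\<bar>
      = \<bar>LINT s|?M. \<Gamma> t s * f s - \<Gamma> t s * g s\<bar>"
    by simp
  also have "\<dots> \<le> (LINT s|?M. \<bar>\<Gamma> t s * f s - \<Gamma> t s * g s\<bar>)"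
    by (rule integral_abs_bound)
  also have "\<dots> \<le> (LINT s|?M. \<Gamma> t s * h s)"
  proof (rule integral_mono_AE)
    show "AE s in ?M. \<bar>\<Gamma> t s * f s - \<Gamma> t s * g s\<bar> \<le> \<Gamma> t s * h s"
      using pos AE_space
    proof eventually_elim
      case (elim s)
      then have "\<Gamma> t s * \<bar>f s - g s\<bar> \<le> \<Gamma> t s * h s"
        using le[of s] by (intro mult_left_mono) auto
      then show ?case
        using elim by (simp add: abs_mult flip: right_diff_distrib)
    qed
  qed simp_all
  finally show ?case
    using le[of t] elim(2) by (simp add: fredholm_op_def)
qed

section \<open>The class \<open>H_class\<close> and the function \<open>tau\<close>\<close>

lemma modulus_diff_le:
  assumes \<omega>: "modulus_of_continuity \<omega>"
  shows "\<omega> \<bar>t - p\<bar> \<le> \<omega> \<bar>s - p\<bar> + \<omega> \<bar>t - s\<bar>"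
proof -
  have "\<omega> \<bar>t - p\<bar> \<le> \<omega> (\<bar>s - p\<bar> + \<bar>t - s\<bar>)"
  proof (rule mono_onD[of "{0..}" \<omega>])
    show "mono_on {0..} \<omega>"
      using \<omega> by (simp add: modulus_of_continuity_def)
  qed auto
  also have "\<dots> \<le> \<omega> \<bar>s - p\<bar> + \<omega> \<bar>t - s\<bar>"
    using \<omega> by (simp add: modulus_of_continuity_def)
  finally show ?thesis .
qed

lemma tau_le: "j \<in> {1..n} \<Longrightarrow> tau n \<omega> q e t \<le> e j + \<omega> \<bar>t - q j\<bar>"
  by (auto simp: tau_def intro!: Min_le)

lemma tau_attained:
  assumes "1 \<le> n"
  obtains j where "j \<in> {1..n}" "tau n \<omega> q e t = e j + \<omega> \<bar>t - q j\<bar>"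
proof -
  have "tau n \<omega> q e t \<in> (\<lambda>j. e j + \<omega> \<bar>t - q j\<bar>) ` {1..n}"
    unfolding tau_def using assms by (intro Min_in) auto
  then show thesis using that by auto
qed

lemma tau_nonneg:
  assumes "1 \<le> n" "modulus_of_continuity \<omega>" "\<forall>j\<in>{1..n}. 0 \<le> e j"
  shows "0 \<le> tau n \<omega> q e t"
  using assms tau_attained[OF assms(1), of \<omega> q e t]
  by (metis add_nonneg_nonneg abs_ge_zero modulus_of_continuity_def)

lemma tau_in_H_class:
  assumes n: "1 \<le> n" and \<omega>: "modulus_of_continuity \<omega>"
  shows "tau n \<omega> q e \<in> H_class a b \<omega>"
proof -
  have "tau n \<omega> q e t \<le> tau n \<omega> q e s + \<omega> \<bar>t - s\<bar>" for s t
  proof -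
    \<comment> \<open>The index attaining the minimum at \<open>s\<close> is a competitor in the
      minimum at \<open>t\<close>.\<close>
    obtain j where j: "j \<in> {1..n}" "tau n \<omega> q e s = e j + \<omega> \<bar>s - q j\<bar>"
      by (rule tau_attained[OF n])
    show ?thesis
      using tau_le[OF j(1), of \<omega> q e t] j(2) modulus_diff_le[OF \<omega>, of t "q j" s] by simp
  qed
  then have "tau n \<omega> q e t - tau n \<omega> q e s \<le> \<omega> \<bar>t - s\<bar>" for s t
    by (simp add: algebra_simps)
  then have "\<bar>tau n \<omega> q e t - tau n \<omega> q e s\<bar> \<le> \<omega> \<bar>t - s\<bar>" for s t
    by (metis abs_minus_commute abs_real_def minus_diff_eq)
  then show ?thesis
    by (simp add: H_class_def)
qed

lemma H_class_uminus: "x \<in> H_class a b \<omega> \<Longrightarrow> (\<lambda>t. - x t) \<in> H_class a b \<omega>"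
  by (simp add: H_class_def abs_minus_commute)

lemma H_class_continuous:
  assumes \<omega>: "modulus_of_continuity \<omega>" and x: "x \<in> H_class a b \<omega>"
  shows "continuous_on {a..b} x"
proof (rule continuous_onI)
  fix t \<epsilon> :: real
  assume t: "t \<in> {a..b}" and "0 < \<epsilon>"
  have "continuous_on {0..} \<omega>" "\<omega> 0 = 0"
    using \<omega> by (auto simp: modulus_of_continuity_def)
  then obtain d where "0 < d" and d: "\<And>u. u \<in> {0..} \<Longrightarrow> dist u 0 < d \<Longrightarrow> dist (\<omega> u) (\<omega> 0) < \<epsilon>"
    using \<open>0 < \<epsilon>\<close> unfolding continuous_on_iff by (meson atLeast_iff order_refl)
  have "dist (x s) (x t) \<le> \<epsilon>" if "s \<in> {a..b}" "dist s t < d" for s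
  proof -
    have "\<bar>x s - x t\<bar> \<le> \<omega> \<bar>s - t\<bar>"
      using x t that(1) by (simp add: H_class_def)
    also have "\<dots> \<le> \<epsilon>"
      using d[of "\<bar>s - t\<bar>"] that(2) \<open>\<omega> 0 = 0\<close> by (simp add: dist_real_def)
    finally show ?thesis by (simp add: dist_real_def)
  qed
  then show "\<exists>d>0. \<forall>s\<in>{a..b}. dist s t < d \<longrightarrow> dist (x s) (x t) \<le> \<epsilon>"
    using \<open>0 < d\<close> by blast
qed

lemma continuous_on_ess_bounded:
  assumes "continuous_on {a..b} x"
  shows "x \<in> ess_bounded a b"
proof -
  have "bounded (x ` {a..b})"
    by (intro compact_imp_bounded compact_continuous_image assms) simp
  then obtain c where "\<forall>t\<in>{a..b}. \<bar>x t\<bar> \<le> c"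
    by (auto simp: bounded_iff)
  then have "AE t in lebesgue_on {a..b}. \<bar>x t\<bar> \<le> c"
    by (intro AE_I2) simp
  moreover have "x \<in> borel_measurable (lebesgue_on {a..b})"
    using assms by (rule continuous_imp_measurable_on_sets_lebesgue) simp
  ultimately show ?thesis
    by (auto simp: ess_bounded_def meas_fun_def)
qed

section \<open>The cells and the piecewise constant operator \<open>L_op\<close>\<close>

lemma Pi_cell_disjoint:
  assumes "i \<in> {1..n}" "j \<in> {1..n}" "t \<in> Pi_cell a b n \<omega> q e i" "t \<in> Pi_cell a b n \<omega> q e j"
  shows "i = j"
proof -
  have "t \<notin> Pi_cell a b n \<omega> q e i" if "i < j" "1 \<le> i" "t \<in> Pi_cell a b n \<omega> q e j" for i j
    using that unfolding Pi_cell.simps[of a b n \<omega> q e j] by auto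
  with assms show ?thesis
    by (meson atLeastAtMost_iff linorder_neqE_nat)
qed

lemma Pi_cell_cover:
  assumes "1 \<le> n" "t \<in> {a..b}"
  obtains j where "j \<in> {1..n}" "t \<in> Pi_cell a b n \<omega> q e j"
proof -
  obtain i where i: "i \<in> {1..n}" "t \<in> Pi_cell' a b n \<omega> q e i"
    using tau_attained[OF assms(1), of \<omega> q e t] assms(2) by (auto simp: Pi_cell'_def)
  show thesis
  proof (cases "t \<in> Pi_cell a b n \<omega> q e i")
    case True
    then show ?thesis using i that by blast
  next
    \<comment> \<open>A point of \<open>Pi_cell'\<close> with index \<open>i\<close> outside cell
      \<open>i\<close> was removed because it belongs to an earlier cell, so \<open>i\<close> need
      not be the first minimizing index.\<close>
    case False
    then show ?thesis
      using i that Pi_cell.simps[of a b n \<omega> q e i] by force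
  qed
qed

lemma L_op_eq:
  assumes "j \<in> {1..n}" "t \<in> Pi_cell a b n \<omega> q e j"
  shows "L_op a b n \<omega> q e z t = z j"
proof -
  have "(THE i. i \<in> {1..n} \<and> t \<in> Pi_cell a b n \<omega> q e i) = j"
    using assms by (intro the_equality) (blast dest: Pi_cell_disjoint)+
  then show ?thesis by (simp add: L_op_def)
qed

lemma Pi_cell_measurable:
  assumes n: "1 \<le> n" and \<omega>: "modulus_of_continuity \<omega>" and q: "q ` {1..n} \<subseteq> {a..b}"
  shows "j \<in> {1..n} \<Longrightarrow> Pi_cell a b n \<omega> q e j \<in> sets (lebesgue_on {a..b})"
proof (induction j rule: less_induct)
  case (less j)
  let ?M = "lebesgue_on {a..b}"
  have [measurable]: "tau n \<omega> q e \<in> borel_measurable ?M"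
    by (rule continuous_imp_measurable_on_sets_lebesgue
        [OF H_class_continuous[OF \<omega> tau_in_H_class[OF n \<omega>]]]) simp
  have "continuous_on {a..b} (\<lambda>t. \<omega> \<bar>t - q j\<bar>)"
  proof (rule continuous_on_compose2[of "{0..}" \<omega>])
    show "continuous_on {0..} \<omega>"
      using \<omega> by (simp add: modulus_of_continuity_def)
  qed (auto intro!: continuous_intros)
  then have [measurable]: "(\<lambda>t. \<omega> \<bar>t - q j\<bar>) \<in> borel_measurable ?M"
    by (rule continuous_imp_measurable_on_sets_lebesgue) simp
  have "{t \<in> space ?M. tau n \<omega> q e t = e j + \<omega> \<bar>t - q j\<bar>} \<in> sets ?M"
    by measurable
  then have "Pi_cell' a b n \<omega> q e j \<in> sets ?M"
    by (simp add: Pi_cell'_def)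
  then show ?case
    unfolding Pi_cell.simps[of a b n \<omega> q e j]
    using less by (intro sets.Diff sets.finite_UN) auto
qed

lemma L_op_ess_bounded:
  assumes n: "1 \<le> n" and \<omega>: "modulus_of_continuity \<omega>" and q: "q ` {1..n} \<subseteq> {a..b}"
  shows "L_op a b n \<omega> q e z \<in> ess_bounded a b"
proof -
  let ?M = "lebesgue_on {a..b}"
  let ?C = "Pi_cell a b n \<omega> q e"
  have val: "\<exists>j\<in>{1..n}. t \<in> ?C j \<and> L_op a b n \<omega> q e z t = z j" if "t \<in> {a..b}" for t
    using Pi_cell_cover[OF n that, of \<omega> q e] L_op_eq by metis
  have eq: "L_op a b n \<omega> q e z t = (\<Sum>j\<in>{1..n}. z j * indicator (?C j) t)" if t: "t \<in> {a..b}" for t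
  proof -
    obtain i where i: "i \<in> {1..n}" "t \<in> ?C i" "L_op a b n \<omega> q e z t = z i"
      using val[OF t] by blast
    have "(\<Sum>j\<in>{1..n}. z j * indicator (?C j) t) = (\<Sum>j\<in>{1..n}. if j = i then z j else 0)"
    proof (rule sum.cong[OF refl])
      fix j assume j: "j \<in> {1..n}"
      have "t \<in> ?C j \<longleftrightarrow> j = i"
        using Pi_cell_disjoint[OF j i(1) _ i(2)] i(2) by blast
      then show "z j * indicator (?C j) t = (if j = i then z j else 0)"
        by (simp add: indicator_def)
    qed
    then show ?thesis using i by simp
  qed
  have "(\<lambda>t. \<Sum>j\<in>{1..n}. z j * indicator (?C j) t) \<in> borel_measurable ?M"
    by (intro borel_measurable_sum borel_measurable_times borel_measurable_const
        borel_measurable_indicator Pi_cell_measurable[OF n \<omega> q])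
  then have "L_op a b n \<omega> q e z \<in> borel_measurable ?M"
    using eq by (subst measurable_cong[of ?M]) auto
  moreover have "AE t in ?M. \<bar>L_op a b n \<omega> q e z t\<bar> \<le> (\<Sum>j\<in>{1..n}. \<bar>z j\<bar>)"
  proof (rule AE_I2)
    fix t assume "t \<in> space ?M"
    then obtain i where "i \<in> {1..n}" "L_op a b n \<omega> q e z t = z i"
      using val[of t] by auto
    then show "\<bar>L_op a b n \<omega> q e z t\<bar> \<le> (\<Sum>j\<in>{1..n}. \<bar>z j\<bar>)"
      using member_le_sum[of i "{1..n}" "\<lambda>j. \<bar>z j\<bar>"] by auto
  qed
  ultimately show ?thesis
    by (auto simp: ess_bounded_def meas_fun_def)
qed

text \<open>On cell \<open>j\<close> the value \<open>z j\<close> differs from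
  \<open>x (q j)\<close> by at most \<open>e j\<close>, and \<open>x (q j)\<close> from
  \<open>x t\<close> by at most \<open>\<omega> \<bar>t - q j\<bar>\<close>; on that cell the sum of
  the two bounds is exactly \<open>tau\<close>.\<close>

lemma L_op_error_le_tau:
  assumes n: "1 \<le> n" and q: "q ` {1..n} \<subseteq> {a..b}"
    and x: "x \<in> H_class a b \<omega>"
    and z: "z \<in> noisy_info n (info_op n q) (error_box n e) x"
    and t: "t \<in> {a..b}"
  shows "\<bar>x t - L_op a b n \<omega> q e z t\<bar> \<le> tau n \<omega> q e t"
proof -
  obtain j where j: "j \<in> {1..n}" "t \<in> Pi_cell a b n \<omega> q e j"
    using Pi_cell_cover[OF n t] .
  then have tau: "tau n \<omega> q e t = e j + \<omega> \<bar>t - q j\<bar>"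
    by (subst (asm) Pi_cell.simps) (auto simp: Pi_cell'_def)
  obtain u where u: "u \<in> error_box n e" "z = (\<lambda>j\<in>{1..n}. info_op n q x j + u j)"
    using z by (auto simp: noisy_info_def)
  have "z j = x (q j) + u j" "\<bar>u j\<bar> \<le> e j"
    using u j(1) by (auto simp: info_op_def error_box_def PiE_iff abs_le_iff)
      force+
  moreover have "q j \<in> {a..b}"
    using q j(1) by blast
  then have "\<bar>x t - x (q j)\<bar> \<le> \<omega> \<bar>t - q j\<bar>"
    using x t by (simp add: H_class_def)
  ultimately show ?thesis
    unfolding L_op_eq[OF j] tau by linarith
qed

section \<open>The lower bound\<close>

text \<open>The admissible noise \<open>- x (q j)\<close> cancels the exact data.\<close>

lemma zero_in_noisy_info:
  assumes "\<forall>j\<in>{1..n}. \<bar>x (q j)\<bar> \<le> e j"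
  shows "(\<lambda>j\<in>{1..n}. 0) \<in> noisy_info n (info_op n q) (error_box n e) x"
proof -
  have "(\<lambda>j\<in>{1..n}. - x (q j)) \<in> error_box n e"
    using assms by (auto simp: error_box_def abs_le_iff)
  moreover have "(\<lambda>j\<in>{1..n}. 0) = (\<lambda>j\<in>{1..n}. info_op n q x j + (\<lambda>j\<in>{1..n}. - x (q j)) j)"
    by (auto simp: info_op_def)
  ultimately show ?thesis
    unfolding noisy_info_def by blast
qed

lemma recovery_error_ge:
  assumes "x \<in> W" "z \<in> noisy_info n I U x"
  shows "ereal (N (\<lambda>t. A x t - \<Phi> z t)) \<le> recovery_error n N A W I U \<Phi>"
  unfolding recovery_error_def using assms by (meson SUP_upper2 SUP_upper)

text \<open>A method answers \<open>x\<close> and \<open>- x\<close> with the same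
  \<open>\<Phi> z\<close>. The two errors differ by \<open>2 * A x\<close>, so by the triangle
  inequality one of them has norm at least \<open>N (A x)\<close>.\<close>

lemma recovery_error_ge_symmetric:
  assumes Y: "normed_lattice a b Y N" and \<Phi>: "\<Phi> \<in> methods n Y"
    and x: "x \<in> W" "(\<lambda>t. - x t) \<in> W" and Ax: "A x \<in> Y" "A (\<lambda>t. - x t) = (\<lambda>t. - A x t)"
    and z: "z \<in> {1..n} \<rightarrow>\<^sub>E UNIV"
    "z \<in> noisy_info n I U x" "z \<in> noisy_info n I U (\<lambda>t. - x t)"
  shows "ereal (N (A x)) \<le> recovery_error n N A W I U \<Phi>"
proof -
  have scale: "\<And>c f. f \<in> Y \<Longrightarrow> (\<lambda>t. c * f t) \<in> Y"
    and Nscale: "\<And>c f. f \<in> Y \<Longrightarrow> N (\<lambda>t. c * f t) = \<bar>c\<bar> * N f"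
    and Nadd: "\<And>f g. f \<in> Y \<Longrightarrow> g \<in> Y \<Longrightarrow> N (\<lambda>t. f t + g t) \<le> N f + N g"
    using Y by (auto simp: normed_lattice_def)
  let ?p = "\<lambda>t. A x t - \<Phi> z t" and ?m = "\<lambda>t. - A x t - \<Phi> z t"
  have "\<Phi> z \<in> Y"
    using \<Phi> z(1) by (auto simp: methods_def)
  then have pm: "?p \<in> Y" "?m \<in> Y"
    using normed_lattice_diff[OF Y] scale[OF Ax(1), of "-1"] Ax(1) by fastforce+
  have "2 * N (A x) = N (\<lambda>t. ?p t + (-1) * ?m t)"
    using Nscale[OF Ax(1), of 2] by simp
  also have "\<dots> \<le> N ?p + N (\<lambda>t. (-1) * ?m t)"
    by (rule Nadd[OF pm(1) scale[OF pm(2)]])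
  also have "N (\<lambda>t. (-1) * ?m t) = N ?m"
    unfolding Nscale[OF pm(2)] by simp
  finally have "N (A x) \<le> N ?p \<or> N (A x) \<le> N ?m" by linarith
  moreover have "ereal (N ?p) \<le> recovery_error n N A W I U \<Phi>"
    by (rule recovery_error_ge[OF x(1) z(2)])
  moreover have "ereal (N ?m) \<le> recovery_error n N A W I U \<Phi>"
    using recovery_error_ge[OF x(2) z(3), of N A \<Phi>] Ax(2) by simp
  ultimately show ?thesis
    using order_trans ereal_less_eq(3) by blast
qed

theorem corollary4:
  fixes a b :: real
    and \<omega> :: "real \<Rightarrow> real"
    and n :: nat
    and q e :: "nat \<Rightarrow> real"
    and k \<Gamma> :: "real \<Rightarrow> real \<Rightarrow> real"
    and A :: "(real \<Rightarrow> real) \<Rightarrow> (real \<Rightarrow> real)"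
    and Y :: "(real \<Rightarrow> real) set"
    and N :: "(real \<Rightarrow> real) \<Rightarrow> real"
    and \<Phi> :: "(nat \<Rightarrow> real) \<Rightarrow> (real \<Rightarrow> real)"
  assumes "a \<le> b"
    and "modulus_of_continuity \<omega>"
    and "1 \<le> n" and "inj_on q {1..n}" and "q ` {1..n} \<subseteq> {a..b}"
    and "\<forall>j\<in>{1..n}. 0 \<le> e j"
    and "case_prod k \<in> borel_measurable (lebesgue_on ({a..b} \<times> {a..b}))"
    and "(\<integral>\<^sup>+ s. (\<integral>\<^sup>+ t. ennreal (\<bar>k t s\<bar>\<^sup>2) \<partial>lebesgue_on {a..b}) \<partial>lebesgue_on {a..b}) < 1"
    and "is_resolvent_kernel a b k \<Gamma>"
    and "A = fredholm_op a b \<Gamma>"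
    and "normed_lattice a b Y N"
    and "ess_bounded a b \<subseteq> Y" and "A ` ess_bounded a b \<subseteq> Y"
    and "AE (t, s) in lebesgue_on ({a..b} \<times> {a..b}). 0 \<le> k t s"
    and "\<Phi> = A \<circ> L_op a b n \<omega> q e"
  shows "optimal_method n Y N A (H_class a b \<omega>) (info_op n q) (error_box n e) \<Phi>
    \<and> optimal_error n Y N A (H_class a b \<omega>) (info_op n q) (error_box n e)
        = recovery_error n N A (H_class a b \<omega>) (info_op n q) (error_box n e) \<Phi>
    \<and> recovery_error n N A (H_class a b \<omega>) (info_op n q) (error_box n e) \<Phi>
        = ereal (N (A (tau n \<omega> q e)))
    \<and> ereal (N (A (tau n \<omega> q e)))
        = ereal (N (\<lambda>t. tau n \<omega> q e t
            + (LINT s|lebesgue_on {a..b}. \<Gamma> t s * tau n \<omega> q e s)))"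
proof -
  note \<omega> = assms(2) and n = assms(3) and q = assms(5) and e = assms(6)
    and A = assms(10) and Y = assms(11)
  let ?H = "H_class a b \<omega>" and ?I = "info_op n q" and ?U = "error_box n e"
  let ?\<tau> = "tau n \<omega> q e" and ?L = "L_op a b n \<omega> q e"
  have \<Gamma>: "AE t in lebesgue_on {a..b}.
      (AE s in lebesgue_on {a..b}. 0 \<le> \<Gamma> t s) \<and> integrable (lebesgue_on {a..b}) (\<Gamma> t)"
    by (rule resolvent_kernel_nonneg_integrable[OF assms(7,8,9,14)])
  have H_bounded: "x \<in> ess_bounded a b" if "x \<in> ?H" for x
    by (rule continuous_on_ess_bounded[OF H_class_continuous[OF \<omega> that]])
  have AY: "A x \<in> Y" if "x \<in> ess_bounded a b" for x
    using assms(13) that by blast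
  have \<tau>: "?\<tau> \<in> ?H"
    by (rule tau_in_H_class[OF n \<omega>])
  have \<Phi>: "\<Phi> \<in> methods n Y"
    using AY[OF L_op_ess_bounded[OF n \<omega> q]] by (simp add: methods_def assms(15))
  have upper: "recovery_error n N A ?H ?I ?U \<Phi> \<le> ereal (N (A ?\<tau>))"
    unfolding recovery_error_def
  proof (intro SUP_least)
    fix x z
    assume x: "x \<in> ?H" and z: "z \<in> noisy_info n ?I ?U x"
    have Lz: "?L z \<in> ess_bounded a b"
      by (rule L_op_ess_bounded[OF n \<omega> q])
    have "(\<lambda>t. A x t - A (?L z) t) \<in> Y"
      by (rule normed_lattice_diff[OF Y AY[OF H_bounded[OF x]] AY[OF Lz]])
    moreover have "AE t in lebesgue_on {a..b}. \<bar>A x t - A (?L z) t\<bar> \<le> A ?\<tau> t"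
      unfolding A
      using fredholm_op_dominated[OF \<Gamma> H_bounded[OF x] Lz H_bounded[OF \<tau>]]
        L_op_error_le_tau[OF n q x z] by blast
    ultimately have "N (\<lambda>t. A x t - A (?L z) t) \<le> N (A ?\<tau>)"
      using normed_lattice_mono[OF Y] AY[OF H_bounded[OF \<tau>]] by blast
    then show "ereal (N (\<lambda>t. A x t - \<Phi> z t)) \<le> ereal (N (A ?\<tau>))"
      by (simp add: assms(15))
  qed
  \<comment> \<open>At a node the competitor with index \<open>j\<close> is \<open>e j\<close>,
    since \<open>\<omega> 0 = 0\<close>. Hence both \<open>?\<tau>\<close> and its negative admit
    zero data.\<close>
  have \<tau>q: "\<bar>?\<tau> (q j)\<bar> \<le> e j" if "j \<in> {1..n}" for j
    using tau_le[OF that, of \<omega> q e "q j"] tau_nonneg[OF n \<omega> e, of q "q j"] \<omega>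
    by (simp add: modulus_of_continuity_def)
  \<comment> \<open>The integral commutes with negation even at its default value 0, so this is an
    equality at every point and not only almost everywhere.\<close>
  have A_minus: "A (\<lambda>t. - ?\<tau> t) = (\<lambda>t. - A ?\<tau> t)"
    by (simp add: A fredholm_op_def)
  have lower: "ereal (N (A ?\<tau>)) \<le> recovery_error n N A ?H ?I ?U \<Psi>"
    if "\<Psi> \<in> methods n Y" for \<Psi>
  proof (rule recovery_error_ge_symmetric[OF Y that \<tau> H_class_uminus[OF \<tau>]
        AY[OF H_bounded[OF \<tau>]] A_minus])
    show "(\<lambda>j\<in>{1..n}. 0) \<in> {1..n} \<rightarrow>\<^sub>E UNIV"
      by simp
    show "(\<lambda>j\<in>{1..n}. 0) \<in> noisy_info n ?I ?U ?\<tau>"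
      by (rule zero_in_noisy_info) (use \<tau>q in blast)
    show "(\<lambda>j\<in>{1..n}. 0) \<in> noisy_info n ?I ?U (\<lambda>t. - ?\<tau> t)"
      by (rule zero_in_noisy_info) (use \<tau>q in simp)
  qed
  have error_eq: "recovery_error n N A ?H ?I ?U \<Phi> = ereal (N (A ?\<tau>))"
    using upper lower[OF \<Phi>] by (rule antisym)
  \<comment> \<open>The lower bound is common to all methods and \<open>\<Phi>\<close> attains it,
    so the infimum is a minimum.\<close>
  have opt: "optimal_error n Y N A ?H ?I ?U = recovery_error n N A ?H ?I ?U \<Phi>"
    unfolding optimal_error_def
    using \<Phi> lower error_eq by (intro antisym INF_lower INF_greatest) auto
  show ?thesis
    using \<Phi> error_eq opt by (simp add: optimal_method_def A fredholm_op_def)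
qed

end
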